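(* Let $p$ be a prime, let $r,m\ge 1$, $s\ge 0$ and $e\ge 2$ be integers with $\gcd(m,p)=1$, put $n=mp^s$ and $R=\mathbb{F}_{p^r}[u]/\langle u^e\rangle$. Let $\lambda=\alpha_1+u\alpha_2+\cdots+u^{e-1}\alpha_e$ with $\alpha_1,\dots,\alpha_e\in\mathbb{F}_{p^r}$, where $\alpha_1=\alpha_0^{p^s}\in\mathbb{F}_{p^r}^*$ for some $\alpha_0\in\mathbb{F}_{p^r}$, and $\alpha_2\ne 0$. Let $f_1,\dots,f_l$ be the irreducible polynomials in $\mathbb{F}_{p^r}[x]$ with $x^n-\alpha_1=\prod_{i=1}^l f_i^{p^s}$. Let $\mathcal{C}$ be the $\lambda$-constacyclic code of length $mp^s$ over $R$ generated by $\prod_{i=1}^l f_i^{s_i}$ with $0\le s_i\le p^se$. Then the dual $\mathcal{C}^\perp$ is a $\lambda^{-1}$-constacyclic code of length $mp^s$. If $\lambda^2=1$, then $\mathcal{C}^\perp$ is a $\lambda$-constacyclic code generated by $$\prod_{i=1}^l (f_i^* )^{p^se-s_i}.$$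
   Context: $R=\mathbb{F}_{p^r}[u]/\langle u^e\rangle=\mathbb{F}_{p^r}+u\mathbb{F}_{p^r}+\cdots+u^{e-1}\mathbb{F}_{p^r}$ with $u^e=0$. For a unit $\lambda\in R$, a $\lambda$-constacyclic code of length $n$ over $R$ is an $R$-submodule of $R^n$ closed under $(c_0,\dots,c_{n-1})\mapsto(\lambda c_{n-1},c_0,\dots,c_{n-2})$; identifying vectors with polynomials of degree less than $n$, these codes are exactly the ideals of $\mathcal{R}=R[x]/\langle x^n-\lambda\rangle$, and "generated by" means generated as an ideal of $\mathcal{R}$. The dual code is $\mathcal{C}^\perp=\{v\in R^n : [v,w]=0 \text{ for all } w\in\mathcal{C}\}$, where $[v,w]=\sum_i v_iw_i$. For a polynomial $f(x)=a_0+a_1x+\cdots+a_dx^d$ with $a_0\neq0$ and $a_d\ne 0$, its reciprocal is $f^*(x)=x^df(x^{-1})=a_d+a_{d-1}x+\cdots+a_0x^d$. The polynomials $f_1,\dots,f_l$ are the pairwise coprime monic irreducible factors of $x^m-\alpha_0$ over $\mathbb{F}_{p^r}$. *)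

theory Defs
  imports "HOL-Computational_Algebra.Polynomial" "HOL-Library.Cardinality" "HOL-Algebra.QuotRing"
begin

text \<open>
  The ring \<open>K[u]/(u^e)\<close>.  The exponent \<open>e\<close> is carried by the finite index type \<open>'e\<close>,
  as \<open>e = CARD('e)\<close>, so that the quotient is a type and \<^typ>\<open>'a poly\<close> over it is available.
\<close>

definition trunc_rel :: "'e::finite itself \<Rightarrow> 'k::field poly \<Rightarrow> 'k poly \<Rightarrow> bool" where
  "trunc_rel T a b \<longleftrightarrow> monom 1 CARD('e) dvd a - b"

lemma equivp_trunc_rel: "equivp (trunc_rel (T :: 'e::finite itself))"
proof (rule equivpI)
  show "reflp (trunc_rel T)"
    by (simp add: reflp_def trunc_rel_def)
  show "symp (trunc_rel T)"
    by (auto simp: symp_def trunc_rel_def dvd_diff_commute)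
  show "transp (trunc_rel T)"
  proof (rule transpI)
    fix a b c assume "trunc_rel T a b" "trunc_rel T b c"
    then have "monom 1 CARD('e) dvd (a - b) + (b - c)"
      unfolding trunc_rel_def by (rule dvd_add)
    then show "trunc_rel T a c" by (simp add: trunc_rel_def)
  qed
qed

quotient_type (overloaded) ('k, 'e) chain_ring =
  "'k::field poly" / "trunc_rel TYPE('e::finite)"
  by (rule equivp_trunc_rel)

instantiation chain_ring :: (field, finite) comm_ring_1
begin

lift_definition zero_chain_ring :: "('a, 'b) chain_ring" is 0 .

lift_definition one_chain_ring :: "('a, 'b) chain_ring" is 1 .

lift_definition plus_chain_ring ::
  "('a, 'b) chain_ring \<Rightarrow> ('a, 'b) chain_ring \<Rightarrow> ('a, 'b) chain_ring" is "(+)"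
  unfolding trunc_rel_def by (metis add_diff_add dvd_add)

lift_definition uminus_chain_ring :: "('a, 'b) chain_ring \<Rightarrow> ('a, 'b) chain_ring" is uminus
  unfolding trunc_rel_def by (metis dvd_diff_commute minus_diff_minus dvd_minus_iff)

lift_definition minus_chain_ring ::
  "('a, 'b) chain_ring \<Rightarrow> ('a, 'b) chain_ring \<Rightarrow> ('a, 'b) chain_ring" is "(-)"
proof -
  fix a b c d :: "'a poly"
  assume "trunc_rel TYPE('b) a b" "trunc_rel TYPE('b) c d"
  then have "monom 1 CARD('b) dvd (a - b) - (c - d)"
    unfolding trunc_rel_def by (rule dvd_diff)
  then show "trunc_rel TYPE('b) (a - c) (b - d)"
    by (simp add: trunc_rel_def algebra_simps)
qed

lift_definition times_chain_ring ::
  "('a, 'b) chain_ring \<Rightarrow> ('a, 'b) chain_ring \<Rightarrow> ('a, 'b) chain_ring" is "(*)"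
proof -
  fix a b c d :: "'a poly"
  assume "trunc_rel TYPE('b) a b" "trunc_rel TYPE('b) c d"
  then have "monom 1 CARD('b) dvd (a - b) * c + b * (c - d)"
    unfolding trunc_rel_def by (intro dvd_add dvd_mult dvd_mult2)
  then show "trunc_rel TYPE('b) (a * c) (b * d)"
    by (simp add: trunc_rel_def algebra_simps)
qed

instance
proof
  fix a b c :: "('a, 'b) chain_ring"
  have refl: "trunc_rel TYPE('b) x x" for x :: "'a poly"
    by (simp add: trunc_rel_def)
  show "a * b * c = a * (b * c)" by transfer (simp add: refl mult.assoc)
  show "a * b = b * a" by transfer (simp add: refl mult.commute)
  show "1 * a = a" by transfer (simp add: refl)
  show "a + b + c = a + (b + c)" by transfer (simp add: refl add.assoc)
  show "a + b = b + a" by transfer (simp add: refl add.commute)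
  show "0 + a = a" by transfer (simp add: refl)
  show "- a + a = 0" by transfer (simp add: refl)
  show "a - b = a + - b" by transfer (simp add: refl)
  show "(a + b) * c = a * c + b * c" by transfer (simp add: refl distrib_right)
  show "(0 :: ('a, 'b) chain_ring) \<noteq> 1"
  proof transfer
    have "\<not> monom 1 CARD('b) dvd (1 :: 'a poly)"
      by (simp add: is_unit_iff_degree degree_monom_eq)
    then show "\<not> trunc_rel TYPE('b) (0 :: 'a poly) 1"
      by (simp add: trunc_rel_def)
  qed
qed

end

lift_definition cr_const :: "'k::field \<Rightarrow> ('k, 'e::finite) chain_ring" is "\<lambda>a. [:a:]" .

lift_definition cr_u :: "('k::field, 'e::finite) chain_ring" is "[:0, 1:]" .

text \<open>Vectors of \<open>R^n\<close> are lists of length \<open>n\<close>, and codes are sets of such lists.\<close>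

definition linear_code :: "nat \<Rightarrow> 'a::comm_ring_1 list set \<Rightarrow> bool" where
  "linear_code n C \<longleftrightarrow>
     (\<forall>c\<in>C. length c = n) \<and>
     replicate n 0 \<in> C \<and>
     (\<forall>c\<in>C. \<forall>d\<in>C. map2 (+) c d \<in> C) \<and>
     (\<forall>a. \<forall>c\<in>C. map ((*) a) c \<in> C)"

definition constacyclic_shift :: "'a::comm_ring_1 \<Rightarrow> 'a list \<Rightarrow> 'a list" where
  "constacyclic_shift lam c = lam * last c # butlast c"

definition constacyclic_code :: "'a::comm_ring_1 \<Rightarrow> nat \<Rightarrow> 'a list set \<Rightarrow> bool" where
  "constacyclic_code lam n C \<longleftrightarrow>
     lam dvd 1 \<and> linear_code n C \<and> (\<forall>c\<in>C. constacyclic_shift lam c \<in> C)"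

definition dual_code :: "nat \<Rightarrow> 'a::comm_ring_1 list set \<Rightarrow> 'a list set" where
  "dual_code n C = {v. length v = n \<and> (\<forall>w\<in>C. (\<Sum>i<n. v ! i * w ! i) = 0)}"

definition poly_ring :: "'a::comm_ring_1 poly ring" where
  "poly_ring = \<lparr>carrier = UNIV, monoid.mult = (*), one = 1, zero = 0, add = (+)\<rparr>"

definition constacyclic_ideal :: "'a::comm_ring_1 \<Rightarrow> nat \<Rightarrow> 'a poly set" where
  "constacyclic_ideal lam n = PIdl\<^bsub>poly_ring\<^esub> (monom 1 n - [:lam:])"

definition constacyclic_ring :: "'a::comm_ring_1 \<Rightarrow> nat \<Rightarrow> 'a poly set ring" where
  "constacyclic_ring lam n = poly_ring Quot constacyclic_ideal lam n"

text \<open>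
  A vector \<open>(c\<^sub>0, \<dots>, c\<^sub>n\<^sub>-\<^sub>1)\<close> is identified with the class of
  \<open>c\<^sub>0 + c\<^sub>1 x + \<dots> + c\<^sub>n\<^sub>-\<^sub>1 x^(n-1)\<close>, which is \<^const>\<open>Poly\<close> of the list; \<open>g\<close> itself may have degree \<open>\<ge> n\<close>.
\<close>

definition residue_class :: "'a::comm_ring_1 \<Rightarrow> nat \<Rightarrow> 'a poly \<Rightarrow> 'a poly set" where
  "residue_class lam n g = constacyclic_ideal lam n +>\<^bsub>poly_ring\<^esub> g"

definition generated_code :: "'a::comm_ring_1 \<Rightarrow> nat \<Rightarrow> 'a poly \<Rightarrow> 'a list set" where
  "generated_code lam n g =
     {c. length c = n \<and>
         residue_class lam n (Poly c) \<in> Idl\<^bsub>constacyclic_ring lam n\<^esub> {residue_class lam n g}}"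

end

theory Submission
  imports Defs
begin

text \<open>
  Write \<open>\<R> = R[x]/(x^n - lam)\<close>.  For the bilinear form, \<open>[v, w]\<close> is the constant term of
  \<open>v(x) w(x\<^sup>-\<^sup>1)\<close> in \<open>\<R>\<close>; when \<open>lam\<^sup>2 = 1\<close> the substitution \<open>x \<mapsto> x\<^sup>-\<^sup>1\<close> is an involution of \<open>\<R>\<close>,
  so the dual of the ideal \<open>(g)\<close> is the image of its annihilator under this involution, which turns
  \<open>f\<close> into \<open>f\<^sup>*\<close> up to a power of the unit \<open>x\<close>.  To compute the annihilator, note that
  \<open>x^n - \<alpha>\<^sub>1\<close> equals \<open>u\<close> times a unit in \<open>\<R>\<close>, because \<open>\<alpha>\<^sub>2 \<noteq> 0\<close>.  Hence \<open>K[x] \<rightarrow> \<R>\<close> is onto with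
  kernel generated by \<open>(x^n - \<alpha>\<^sub>1)^e\<close>, where \<open>K\<close> is the residue field, and if \<open>g h = (x^n - \<alpha>\<^sub>1)^e\<close>
  then the annihilator of \<open>g\<close> is \<open>(h)\<close>.
\<close>

section \<open>Congruences modulo an element of a commutative ring\<close>

definition congr :: "'a::comm_ring_1 \<Rightarrow> 'a \<Rightarrow> 'a \<Rightarrow> bool" where
  "congr N a b \<longleftrightarrow> N dvd a - b"

lemma congr_refl [simp]: "congr N a a"
  by (simp add: congr_def)

lemma congr_sym: "congr N a b \<Longrightarrow> congr N b a"
  unfolding congr_def by (metis dvd_minus_iff minus_diff_eq)

lemma congr_trans [trans]: "congr N a b \<Longrightarrow> congr N b c \<Longrightarrow> congr N a c"
  unfolding congr_def by (metis diff_add_cancel add_diff_eq dvd_add)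

lemma congr_add: "congr N a b \<Longrightarrow> congr N c d \<Longrightarrow> congr N (a + c) (b + d)"
  unfolding congr_def by (metis add_diff_add dvd_add)

lemma congr_mult:
  assumes "congr N a b" "congr N c d"
  shows "congr N (a * c) (b * d)"
proof -
  have "a * c - b * d = (a - b) * c + b * (c - d)"
    by (simp add: algebra_simps)
  then show ?thesis
    using assms by (simp add: congr_def)
qed

lemma congr_power: "congr N a b \<Longrightarrow> congr N (a ^ k) (b ^ k)"
  by (induction k) (auto intro: congr_mult)

lemma congr_prod: "(\<And>i. i \<in> A \<Longrightarrow> congr N (f i) (g i)) \<Longrightarrow> congr N (prod f A) (prod g A)"
  by (induction A rule: infinite_finite_induct) (auto intro: congr_mult)

lemma congr_sum: "(\<And>i. i \<in> A \<Longrightarrow> congr N (f i) (g i)) \<Longrightarrow> congr N (sum f A) (sum g A)"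
  by (induction A rule: infinite_finite_induct) (auto intro: congr_add)

lemma congr_0_iff: "congr N a 0 \<longleftrightarrow> N dvd a"
  by (simp add: congr_def)

lemma congr_dvd_iff: "congr N a b \<Longrightarrow> N dvd a \<longleftrightarrow> N dvd b"
  by (metis congr_0_iff congr_sym congr_trans)

lemma congr_pcompose:
  fixes a :: "'a::comm_ring_1 poly"
  assumes "congr N y z"
  shows "congr N (pcompose a y) (pcompose a z)"
  using assms
  by (induction a) (auto simp: pcompose_pCons intro: congr_add congr_mult)

text \<open>The substitution of \<open>y\<close> for the variable descends to the quotient by
  \<open>N\<close> once it maps the ideal of \<open>N\<close> into itself: from a - b = N q follows
  a(y) - b(y) = N(y) q(y).\<close>

lemma congr_pcompose_left:
  fixes a :: "'a::comm_ring_1 poly"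
  assumes "N dvd pcompose N y" "congr N a b"
  shows "congr N (pcompose a y) (pcompose b y)"
proof -
  obtain q where "a - b = N * q"
    using assms(2) by (auto simp: congr_def)
  then have "pcompose a y - pcompose b y = pcompose N y * pcompose q y"
    by (metis pcompose_diff pcompose_mult)
  then show ?thesis
    using assms(1) by (simp add: congr_def)
qed

section \<open>The chain ring\<close>

lemma cr_const_0 [simp]: "cr_const 0 = 0"
  by transfer (simp add: trunc_rel_def)

lemma cr_const_1 [simp]: "cr_const 1 = 1"
  by transfer (simp add: trunc_rel_def pCons_one)

lemma cr_const_add: "cr_const (a + b) = cr_const a + cr_const b"
  by transfer (simp add: trunc_rel_def)

lemma cr_const_mult: "cr_const (a * b) = cr_const a * cr_const b"
  by transfer (simp add: trunc_rel_def)

lemma cr_const_sum: "cr_const (sum f A) = (\<Sum>i\<in>A. cr_const (f i))"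
  by (induction A rule: infinite_finite_induct) (auto simp: cr_const_add)

lemma cr_const_uminus: "cr_const (- a) = - cr_const a"
  by (metis cr_const_0 cr_const_add add.right_inverse minus_unique)

lemma cr_u_power: "cr_u ^ k = (abs_chain_ring (monom 1 k) :: ('k::field, 'e::finite) chain_ring)"
proof (induction k)
  case 0
  show ?case
    by (simp add: one_chain_ring.abs_eq flip: one_pCons)
next
  case (Suc k)
  have "[:0, 1:] * monom 1 k = (monom 1 (Suc k) :: 'k poly)"
    by (simp add: monom_Suc)
  then show ?case
    using Suc by (simp add: cr_u.abs_eq times_chain_ring.abs_eq)
qed

lemma chain_ring_abs_eq_iff:
  "(abs_chain_ring a :: ('k::field, 'e::finite) chain_ring) = abs_chain_ring b \<longleftrightarrow>
     monom 1 CARD('e) dvd a - b"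
  by (simp add: chain_ring.abs_eq_iff trunc_rel_def)

lemma cr_u_nilpotent: "cr_u ^ CARD('e) = (0 :: ('k::field, 'e::finite) chain_ring)"
  by (simp add: cr_u_power zero_chain_ring.abs_eq chain_ring_abs_eq_iff)

text \<open>A nonzero monomial of degree e - 1 cannot be a multiple of u^e. This detects residue
  field elements inside the socle of the chain ring.\<close>

lemma cr_u_power_mult_const_eq_0:
  assumes "cr_u ^ (CARD('e) - 1) * cr_const c = (0 :: ('k::field, 'e::finite) chain_ring)"
  shows "c = 0"
proof (rule ccontr)
  assume "c \<noteq> 0"
  have "monom 1 (CARD('e) - 1) * [:c:] = monom c (CARD('e) - 1)"
    by (simp add: monom_altdef)
  then have "monom 1 CARD('e) dvd monom c (CARD('e) - 1)"
    using assms
    by (simp add: cr_u_power cr_const.abs_eq times_chain_ring.abs_eq zero_chain_ring.abs_eq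
        chain_ring_abs_eq_iff)
  then have "degree (monom 1 CARD('e) :: 'k poly) \<le> degree (monom c (CARD('e) - 1))"
    using \<open>c \<noteq> 0\<close> by (intro dvd_imp_degree_le) auto
  then show False
    using \<open>c \<noteq> 0\<close> zero_less_card_finite[where 'a = 'e]
    by (simp add: degree_monom_eq del: zero_less_card_finite)
qed

text \<open>Obtained by splitting off the constant coefficient of a representing polynomial;
  \<open>c\<close> is the image of \<open>a\<close> in the residue field.\<close>

lemma chain_ring_decomp:
  fixes a :: "('k::field, 'e::finite) chain_ring"
  obtains c b where "a = cr_const c + cr_u * b"
proof -
  obtain q where q: "a = abs_chain_ring q"
    by (metis chain_ring.abs_eq_iff Quotient_rel_rep Quotient_chain_ring Quotient_abs_rep)
  obtain c q' where "q = pCons c q'"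
    by (rule pCons_cases)
  then have "q = [:c:] + [:0, 1:] * q'"
    by simp
  then have "a = cr_const c + cr_u * abs_chain_ring q'"
    using q by (simp add: cr_u.abs_eq cr_const.abs_eq times_chain_ring.abs_eq plus_chain_ring.abs_eq)
  then show ?thesis
    by (rule that)
qed

text \<open>A unit plus a nilpotent element is a unit. Here \<open>z\<close> is chosen so that 1 - z
  is the given element divided by \<open>c\<close>, and the geometric series in \<open>z\<close> is
  finite.\<close>

lemma chain_ring_unit:
  fixes b :: "('k::field, 'e::finite) chain_ring"
  assumes "c \<noteq> 0"
  obtains v where "(cr_const c + cr_u * b) * v = 1"
proof -
  define z where "z = cr_const (- inverse c) * cr_u * b"
  have z: "z ^ CARD('e) = 0"
    by (simp add: z_def power_mult_distrib cr_u_nilpotent)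
  have c: "cr_const c * cr_const (inverse c) = (1 :: ('k, 'e) chain_ring)"
    using assms by (simp flip: cr_const_mult)
  have "1 = (1 - z) * (\<Sum>i<CARD('e). z ^ i)"
    using one_diff_power_eq[of z "CARD('e)"] z by simp
  also have "1 - z = (cr_const c + cr_u * b) * cr_const (inverse c)"
    using c by (simp add: z_def algebra_simps cr_const_uminus)
  finally show ?thesis
    using that by (metis mult.assoc)
qed

section \<open>Extension of scalars\<close>

abbreviation lift_poly :: "'k::field poly \<Rightarrow> ('k, 'e::finite) chain_ring poly" where
  "lift_poly \<equiv> map_poly cr_const"

lemma coeff_lift_poly: "coeff (lift_poly a) i = cr_const (coeff a i)"
  by (simp add: coeff_map_poly)

lemma lift_poly_add: "lift_poly (a + b) = lift_poly a + lift_poly b"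
  by (rule poly_eqI) (simp add: coeff_lift_poly cr_const_add)

lemma lift_poly_diff: "lift_poly (a - b) = lift_poly a - lift_poly b"
  by (metis add_diff_cancel diff_add_cancel lift_poly_add)

lemma lift_poly_mult: "lift_poly (a * b) = lift_poly a * lift_poly b"
  by (rule poly_eqI) (simp add: coeff_lift_poly coeff_mult cr_const_sum cr_const_mult)

lemma lift_poly_1: "lift_poly 1 = 1"
  by (rule poly_eqI) (simp add: coeff_lift_poly)

lemma lift_poly_power: "lift_poly (a ^ k) = lift_poly a ^ k"
  by (induction k) (auto simp: lift_poly_1 lift_poly_mult)

lemma lift_poly_prod: "lift_poly (prod f A) = (\<Prod>i\<in>A. lift_poly (f i))"
  by (induction A rule: infinite_finite_induct) (auto simp: lift_poly_1 lift_poly_mult)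

lemma cr_const_eq_0_iff: "cr_const c = (0 :: ('k::field, 'e::finite) chain_ring) \<longleftrightarrow> c = 0"
  using cr_u_power_mult_const_eq_0[where 'e = 'e and c = c] by auto

text \<open>Injectivity of \<open>cr_const\<close> preserves the degree, hence also the point about
  which the coefficients are reversed.\<close>

lemma lift_poly_reflect:
  "lift_poly (reflect_poly a) = (reflect_poly (lift_poly a) :: ('k::field, 'e::finite) chain_ring poly)"
proof -
  have "degree (lift_poly a :: ('k, 'e) chain_ring poly) = degree a"
    by (cases "a = 0") (simp_all add: degree_map_poly cr_const_eq_0_iff)
  then show ?thesis
    by (intro poly_eqI) (simp add: coeff_lift_poly coeff_reflect_poly)
qed

lemma poly_decomp:
  fixes a :: "('k::field, 'e::finite) chain_ring poly"
  obtains a0 b where "a = lift_poly a0 + [:cr_u:] * b"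
proof -
  have "\<exists>a0 b. a = lift_poly a0 + [:cr_u:] * b"
  proof (induction a)
    case 0
    show ?case
      by (rule exI[of _ 0], rule exI[of _ 0]) simp
  next
    case (pCons c a)
    obtain a0 b where ab: "a = lift_poly a0 + [:cr_u:] * b"
      using pCons by blast
    obtain c0 d where cd: "c = cr_const c0 + cr_u * d"
      by (rule chain_ring_decomp)
    have "pCons c a = lift_poly (pCons c0 a0) + [:cr_u:] * pCons d b"
      using ab cd by (simp add: map_poly_pCons)
    then show ?case
      by blast
  qed
  then show ?thesis
    using that by blast
qed

section \<open>Generated codes as congruence classes\<close>

lemma cring_poly_ring: "cring (poly_ring :: 'a::comm_ring_1 poly ring)"
proof -
  have "\<exists>y. y + x = 0" for x :: "'a poly"
    by (rule exI[of _ "- x"]) simp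
  then show ?thesis
    by (intro cringI abelian_groupI comm_monoidI)
      (simp_all add: poly_ring_def ac_simps distrib_left)
qed

lemma constacyclic_ideal_eq: "constacyclic_ideal lam n = {a. monom 1 n - [:lam:] dvd a}"
  by (auto simp: constacyclic_ideal_def cgenideal_def poly_ring_def dvd_def mult.commute)

lemma ideal_constacyclic_ideal: "ideal (constacyclic_ideal lam n) poly_ring"
  unfolding constacyclic_ideal_def
  by (rule cring.cgenideal_ideal[OF cring_poly_ring]) (simp add: poly_ring_def)

lemma residue_class_eq: "residue_class lam n g = {a. congr (monom 1 n - [:lam:]) a g}"
proof -
  have "congr (monom 1 n - [:lam:]) a g \<longleftrightarrow> (\<exists>h\<in>constacyclic_ideal lam n. a = h + g)" for a
  proof
    assume "congr (monom 1 n - [:lam:]) a g"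
    then show "\<exists>h\<in>constacyclic_ideal lam n. a = h + g"
      unfolding congr_def constacyclic_ideal_eq by (intro bexI[of _ "a - g"]) simp_all
  next
    assume "\<exists>h\<in>constacyclic_ideal lam n. a = h + g"
    then obtain h where "monom 1 n - [:lam:] dvd h" "a = h + g"
      unfolding constacyclic_ideal_eq by blast
    then show "congr (monom 1 n - [:lam:]) a g"
      by (simp add: congr_def)
  qed
  then show ?thesis
    unfolding residue_class_def a_r_coset_def' by (auto simp: poly_ring_def)
qed

lemma residue_class_eq_iff:
  "residue_class lam n a = residue_class lam n b \<longleftrightarrow> congr (monom 1 n - [:lam:]) a b"
proof
  assume "residue_class lam n a = residue_class lam n b"
  then show "congr (monom 1 n - [:lam:]) a b"
    unfolding residue_class_eq by (metis congr_refl mem_Collect_eq)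
next
  assume "congr (monom 1 n - [:lam:]) a b"
  then have "congr (monom 1 n - [:lam:]) x a \<longleftrightarrow> congr (monom 1 n - [:lam:]) x b" for x
    by (metis congr_sym congr_trans)
  then show "residue_class lam n a = residue_class lam n b"
    unfolding residue_class_eq by simp
qed

text \<open>In the commutative quotient ring the ideal generated by one class consists of its
  multiples. All later arguments use this description by congruences instead of cosets.\<close>

lemma mem_generated_code_iff:
  "c \<in> generated_code lam n g \<longleftrightarrow>
     length c = n \<and> (\<exists>a. congr (monom 1 n - [:lam:]) (Poly c) (g * a))"
proof -
  let ?Q = "constacyclic_ring lam n"
  interpret I: ideal "constacyclic_ideal lam n" poly_ring
    by (rule ideal_constacyclic_ideal)
  interpret Q: cring ?Q
    unfolding constacyclic_ring_def by (rule I.quotient_is_cring[OF cring_poly_ring])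
  have carrier: "carrier ?Q = range (residue_class lam n)"
    by (auto simp: constacyclic_ring_def FactRing_def A_RCOSETS_def' residue_class_def)
      (auto simp: poly_ring_def)
  have mult: "residue_class lam n a \<otimes>\<^bsub>?Q\<^esub> residue_class lam n b = residue_class lam n (a * b)"
    for a b
    using I.rcoset_mult_add[of a b]
    by (simp add: constacyclic_ring_def FactRing_def residue_class_def) (simp add: poly_ring_def)
  have "Idl\<^bsub>?Q\<^esub> {residue_class lam n g} = PIdl\<^bsub>?Q\<^esub> (residue_class lam n g)"
    by (simp add: Q.cgenideal_eq_genideal carrier)
  also have "\<dots> = (\<lambda>x. x \<otimes>\<^bsub>?Q\<^esub> residue_class lam n g) ` range (residue_class lam n)"
    by (auto simp: carrier cgenideal_def)
  also have "\<dots> = range (\<lambda>a. residue_class lam n (g * a))"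
    by (simp add: image_image mult mult.commute)
  finally show ?thesis
    by (auto simp: generated_code_def residue_class_eq_iff)
qed

section \<open>Representatives of degree less than \<open>n\<close>\<close>

lemma Poly_as_sum: "Poly v = (\<Sum>i<length v. monom (v ! i) i)"
  by (rule poly_eqI) (simp add: nth_default_def coeff_sum)

text \<open>Division by the monic polynomial x^n - lam, carried out one coefficient at a time by
  induction on the polynomial.\<close>

lemma ex_reduced_representative:
  fixes a :: "'a::comm_ring_1 poly"
  assumes "n \<ge> 1"
  obtains v where "length v = n" "congr (monom 1 n - [:lam:]) a (Poly v)"
proof -
  let ?N = "monom 1 n - [:lam:]"
  have "\<exists>v. length v = n \<and> congr ?N a (Poly v)"
  proof (induction a)
    case 0
    have "Poly (replicate n 0 :: 'a list) = 0"
      by (rule poly_eqI) (simp add: nth_default_def)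
    then show ?case
      by (intro exI[of _ "replicate n 0"]) simp
  next
    case (pCons c a)
    obtain v where v: "length v = n" "congr ?N a (Poly v)"
      using pCons by blast
    \<comment> \<open>The polynomial c + x v(x) has a top term of degree n. Replacing x^n by
      \<open>lam\<close> yields the constacyclic shift of \<open>v\<close>, with \<open>c\<close>
      added to its first entry.\<close>
    define w where "w = (c + lam * last v) # butlast v"
    have "v \<noteq> []"
      using v assms by auto
    then have snoc: "butlast v @ [last v] = v"
      by simp
    have len: "length w = n"
      using v assms by (simp add: w_def)
    have "pCons 0 (Poly v) = pCons 0 (Poly (butlast v @ [last v]))"
      by (simp only: snoc)
    also have "\<dots> = pCons 0 (Poly (butlast v)) + monom (last v) n"
      using v assms
      by (intro poly_eqI)
        (auto simp: coeff_pCons nth_default_def nth_append nth_butlast split: nat.splits)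
    finally have v_eq: "pCons 0 (Poly v) = pCons 0 (Poly (butlast v)) + monom (last v) n" .
    have pCons_v: "pCons c (Poly v) = [:c:] + pCons 0 (Poly v)"
      by simp
    have Poly_w: "Poly w = [:c:] + [:lam * last v:] + pCons 0 (Poly (butlast v))"
      by (simp add: w_def)
    have cancel: "x + (y + z) - (x + x' + y) = z - x'" for x y z x' :: "'a poly"
      by simp
    have "pCons c (Poly v) - Poly w = monom (last v) n - [:lam * last v:]"
      by (subst pCons_v, subst Poly_w, subst v_eq) (rule cancel)
    also have "\<dots> = [:last v:] * ?N"
      by (simp add: smult_diff_right smult_monom mult.commute)
    finally have "pCons c (Poly v) - Poly w = [:last v:] * ?N" .
    then have "congr ?N (pCons c (Poly v)) (Poly w)"
      by (metis congr_def dvd_triv_right)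
    moreover have "congr ?N (pCons c a) (pCons c (Poly v))"
      using congr_mult[OF congr_refl[of ?N "[:0, 1:]"] v(2)]
      by (simp add: congr_def)
    ultimately show ?case
      using len congr_trans by blast
  qed
  then show ?thesis
    using that by blast
qed

section \<open>Duality through the trace form\<close>

text \<open>
  The constant term of the representative of degree less than \<open>n\<close>: since \<open>x^n = lam\<close>, the monomial
  \<open>x^i\<close> contributes exactly when \<open>n\<close> divides \<open>i\<close>.
\<close>

definition constacyclic_trace :: "'a::comm_ring_1 \<Rightarrow> nat \<Rightarrow> 'a poly \<Rightarrow> 'a" where
  "constacyclic_trace lam n a =
     (\<Sum>i\<le>degree a. coeff a i * (if n dvd i then lam ^ (i div n) else 0))"

text \<open>Any bound on the degree may end the sum, so that two polynomials can share one range of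
  summation.\<close>

lemma constacyclic_trace_altdef:
  assumes "degree a \<le> d"
  shows "constacyclic_trace lam n a =
    (\<Sum>i\<le>d. coeff a i * (if n dvd i then lam ^ (i div n) else 0))"
  unfolding constacyclic_trace_def
  using assms by (intro sum.mono_neutral_left) (auto simp: coeff_eq_0)

lemma constacyclic_trace_add:
  "constacyclic_trace lam n (a + b) = constacyclic_trace lam n a + constacyclic_trace lam n b"
proof -
  define d where "d = max (degree a) (degree b)"
  have "degree a \<le> d" "degree b \<le> d" "degree (a + b) \<le> d"
    by (auto simp: d_def degree_add_le_max)
  then show ?thesis
    by (simp add: constacyclic_trace_altdef[of _ d] distrib_right sum.distrib)
qed

lemma constacyclic_trace_0 [simp]: "constacyclic_trace lam n 0 = 0"
  by (simp add: constacyclic_trace_def)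

lemma constacyclic_trace_sum:
  "constacyclic_trace lam n (\<Sum>i\<in>A. f i) = (\<Sum>i\<in>A. constacyclic_trace lam n (f i))"
  by (induction A rule: infinite_finite_induct) (auto simp: constacyclic_trace_add)

lemma constacyclic_trace_diff:
  "constacyclic_trace lam n (a - b) = constacyclic_trace lam n a - constacyclic_trace lam n b"
  by (metis add_diff_cancel_right' constacyclic_trace_add diff_add_cancel)

lemma constacyclic_trace_monom:
  "constacyclic_trace lam n (monom c i) = (if n dvd i then c * lam ^ (i div n) else 0)"
proof -
  have "constacyclic_trace lam n (monom c i) =
    (\<Sum>j\<le>i. coeff (monom c i) j * (if n dvd j then lam ^ (j div n) else 0))"
    by (rule constacyclic_trace_altdef) (rule degree_monom_le)
  also have "\<dots> = (\<Sum>j\<in>{i}. coeff (monom c i) j * (if n dvd j then lam ^ (j div n) else 0))"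
    by (rule sum.mono_neutral_right) auto
  finally show ?thesis
    by simp
qed

text \<open>By linearity it suffices to treat (x^n - lam) c x^i. Its two terms cancel: passing from
  i to n + i raises the quotient by n by one, which costs exactly a factor
  \<open>lam\<close>.\<close>

lemma constacyclic_trace_eq_0:
  assumes "n \<ge> 1" "monom 1 n - [:lam:] dvd a"
  shows "constacyclic_trace lam n a = 0"
proof -
  obtain q where q: "a = (monom 1 n - [:lam:]) * q"
    using assms(2) by (auto simp: dvd_def)
  have "constacyclic_trace lam n ((monom 1 n - [:lam:]) * monom c i) = 0" for c i
  proof -
    have "(monom 1 n - [:lam:]) * monom c i = monom c (n + i) - monom (lam * c) i"
      by (simp add: left_diff_distrib mult_monom smult_monom)
    then show ?thesis
      using assms(1)
      by (simp add: constacyclic_trace_diff constacyclic_trace_monom)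
  qed
  moreover have "a = (\<Sum>i\<le>degree q. (monom 1 n - [:lam:]) * monom (coeff q i) i)"
    using q poly_as_sum_of_monoms[of q] by (metis sum_distrib_left)
  ultimately show ?thesis
    by (metis (no_types, lifting) constacyclic_trace_sum sum.neutral)
qed

lemma constacyclic_trace_congr:
  assumes "n \<ge> 1" "congr (monom 1 n - [:lam:]) a b"
  shows "constacyclic_trace lam n a = constacyclic_trace lam n b"
  using constacyclic_trace_eq_0[OF assms(1)] assms(2)
  by (metis congr_def constacyclic_trace_diff eq_iff_diff_eq_0)

text \<open>Modulo n the factor n - 1 is -1, so the sum is i - j, and both indices lie below n. It
  is the exponent that occurs in x^i times the j-th power of \<open>x_inv\<close>.\<close>

lemma dvd_add_mult_pred_iff:
  fixes n :: nat
  assumes "i < n" "j < n"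
  shows "n dvd i + (n - 1) * j \<longleftrightarrow> i = j"
proof
  assume "n dvd i + (n - 1) * j"
  then have "(i + (n - 1) * j + j) mod n = j"
    using assms by (metis dvd_def mod_mult_self4 mod_less)
  moreover have "i + (n - 1) * j + j = n * j + i"
    using assms by (cases n) auto
  ultimately show "i = j"
    using assms by (metis mod_mult_self4 mod_less)
next
  assume "i = j"
  moreover have "i + (n - 1) * i = n * i"
    using assms by (cases n) auto
  ultimately show "n dvd i + (n - 1) * j"
    by simp
qed

section \<open>The involution inverting x when lam^2 = 1\<close>

locale self_inverse_constacyclic =
  fixes lam :: "'a::comm_ring_1" and n :: nat
  assumes n_pos: "n \<ge> 1" and lam_square: "lam * lam = 1"
begin

abbreviation "modulus \<equiv> monom 1 n - [:lam:]"

abbreviation cong_mod (infix \<open>\<cong>\<close> 50) where "cong_mod \<equiv> congr modulus"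

text \<open>An explicit polynomial inverse of x: the product with x is lam x^n, which is congruent
  to lam^2 = 1.\<close>

definition x_inv :: "'a poly" where "x_inv = monom lam (n - 1)"

abbreviation invert :: "'a poly \<Rightarrow> 'a poly" where "invert a \<equiv> pcompose a x_inv"

lemma x_mult_inv: "[:0, 1:] * x_inv = monom lam n"
proof -
  have "Suc (n - 1) = n"
    using n_pos by simp
  then have "pCons 0 (monom lam (n - 1)) = monom lam n"
    by (metis monom_Suc)
  then show ?thesis
    by (simp add: x_inv_def)
qed

lemma monom_n_cong: "monom lam n \<cong> 1"
proof -
  have "monom lam n - 1 = [:lam:] * modulus"
    by (simp add: smult_diff_right smult_monom lam_square one_pCons)
  then show ?thesis
    by (metis congr_def dvd_triv_right)
qed

lemma x_mult_inv_cong: "[:0, 1:] * x_inv \<cong> 1"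
  unfolding x_mult_inv by (rule monom_n_cong)

lemma x_inv_power_cong: "[:0, 1:] ^ k * x_inv ^ k \<cong> 1"
  using congr_power[OF x_mult_inv_cong, of k] by (simp only: power_mult_distrib power_one)

lemma x_inv_power_n: "x_inv ^ n \<cong> [:lam:]"
proof -
  have x_n: "[:0, 1:] ^ n = (monom 1 n :: 'a poly)"
    by (simp add: monom_altdef)
  \<comment> \<open>The factor 1 is traded for lam x^n, whose power of x then cancels against
    \<open>x_inv ^ n\<close>.\<close>
  have "x_inv ^ n = x_inv ^ n * 1"
    by simp
  also have "\<dots> \<cong> x_inv ^ n * (monom 1 n * [:lam:])"
    using congr_sym[OF monom_n_cong] by (intro congr_mult) (auto simp: smult_monom)
  also have "\<dots> = ([:0, 1:] ^ n * x_inv ^ n) * [:lam:]"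
    by (simp add: x_n mult_ac)
  also have "\<dots> \<cong> 1 * [:lam:]"
    by (intro congr_mult x_inv_power_cong) auto
  finally show ?thesis
    by simp
qed

lemma invert_x: "invert [:0, 1:] = x_inv"
  by (simp add: pcompose_pCons)

lemma invert_power: "invert (a ^ k) = invert a ^ k"
  by (induction k) (auto simp: pcompose_mult pcompose_1)

lemma invert_prod: "invert (prod f A) = (\<Prod>i\<in>A. invert (f i))"
  by (induction A rule: infinite_finite_induct) (auto simp: pcompose_mult pcompose_1)

text \<open>The n-th power of the inverse of x is the inverse of \<open>lam\<close>, which is
  \<open>lam\<close> itself. Hence inversion of x is well defined on the quotient by the same
  modulus.\<close>

lemma modulus_dvd_invert: "modulus dvd invert modulus"
proof -
  have "invert (monom 1 n) = x_inv ^ n"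
    using invert_power[of "[:0, 1:]" n] by (simp add: monom_altdef invert_x)
  then have "invert modulus = x_inv ^ n - [:lam:]"
    by (simp add: pcompose_diff)
  then show ?thesis
    using x_inv_power_n by (simp add: congr_def)
qed

lemma invert_cong: "a \<cong> b \<Longrightarrow> invert a \<cong> invert b"
  by (rule congr_pcompose_left[OF modulus_dvd_invert])

text \<open>Applying \<open>invert\<close> to the relation between x and \<open>x_inv\<close> shows
  that \<open>invert x_inv\<close> is an inverse of \<open>x_inv\<close>; inverses are unique, and x
  is one.\<close>

lemma invert_x_inv: "invert x_inv \<cong> [:0, 1:]"
proof -
  have "x_inv * invert x_inv = invert ([:0, 1:] * x_inv)"
    by (simp only: pcompose_mult invert_x)
  also have "\<dots> \<cong> invert 1"
    by (rule invert_cong[OF x_mult_inv_cong])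
  finally have *: "x_inv * invert x_inv \<cong> 1"
    by (simp add: pcompose_1)
  have "invert x_inv = 1 * invert x_inv"
    by simp
  also have "\<dots> \<cong> ([:0, 1:] * x_inv) * invert x_inv"
    by (intro congr_mult congr_sym[OF x_mult_inv_cong]) auto
  also have "\<dots> = [:0, 1:] * (x_inv * invert x_inv)"
    by (simp only: mult.assoc)
  also have "\<dots> \<cong> [:0, 1:] * 1"
    by (intro congr_mult * congr_refl)
  finally show ?thesis
    by simp
qed

lemma invert_invert: "invert (invert a) \<cong> a"
proof -
  have "invert (invert a) = pcompose a (invert x_inv)"
    by (simp add: pcompose_assoc)
  also have "\<dots> \<cong> pcompose a [:0, 1:]"
    by (rule congr_pcompose[OF invert_x_inv])
  finally show ?thesis
    by (simp add: pcompose_idR)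
qed

text \<open>For i = j the product has exponent n j, so the trace contributes lam^j; the coefficient
  lam^j coming from \<open>x_inv ^ j\<close> cancels it because lam^2 = 1.\<close>

lemma trace_monom_mult_invert:
  assumes "i < n" "j < n"
  shows "constacyclic_trace lam n (monom a i * invert (monom b j)) = (if i = j then a * b else 0)"
proof -
  have "invert (monom b j) = [:b:] * x_inv ^ j"
    using invert_power[of "[:0, 1:]" j]
    by (simp add: monom_altdef pcompose_smult invert_x)
  also have "\<dots> = monom (b * lam ^ j) ((n - 1) * j)"
    by (simp add: x_inv_def monom_power smult_monom)
  finally have "monom a i * invert (monom b j) = monom (a * b * lam ^ j) (i + (n - 1) * j)"
    by (simp add: mult_monom mult_ac)
  moreover have "(i + (n - 1) * i) div n = i"
  proof -
    have "i + (n - 1) * i = n * i"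
      using assms by (cases n) auto
    then show ?thesis
      using n_pos by simp
  qed
  moreover have "lam ^ j * lam ^ j = 1"
    using lam_square by (metis power_mult_distrib power_one)
  ultimately show ?thesis
    using dvd_add_mult_pred_iff[OF assms]
    by (auto simp: constacyclic_trace_monom mult.assoc)
qed

lemma trace_Poly_mult_invert:
  assumes "length v = n" "length w = n"
  shows "constacyclic_trace lam n (Poly v * invert (Poly w)) = (\<Sum>i<n. v ! i * w ! i)"
proof -
  have "invert (Poly w) = (\<Sum>j<n. invert (monom (w ! j) j))"
    by (simp add: Poly_as_sum[of w] assms pcompose_sum)
  then have "Poly v * invert (Poly w) =
      (\<Sum>i<n. \<Sum>j<n. monom (v ! i) i * invert (monom (w ! j) j))"
    by (simp add: Poly_as_sum[of v] assms sum_product)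
  then have "constacyclic_trace lam n (Poly v * invert (Poly w)) =
      (\<Sum>i<n. \<Sum>j<n. if i = j then v ! i * w ! j else 0)"
    by (simp add: constacyclic_trace_sum trace_monom_mult_invert)
  then show ?thesis
    by simp
qed

text \<open>Testing against the inverse of x^i reads off the i-th coefficient of the reduced
  representative.\<close>

lemma trace_nondegenerate:
  assumes "\<And>b. constacyclic_trace lam n (a * b) = 0"
  shows "modulus dvd a"
proof -
  obtain v where v: "length v = n" "a \<cong> Poly v"
    using ex_reduced_representative[OF n_pos] by metis
  have "v ! i = 0" if "i < n" for i
  proof -
    have "Poly v = (\<Sum>j<n. monom (v ! j) j)"
      by (simp add: Poly_as_sum[of v] v)
    then have "constacyclic_trace lam n (Poly v * invert (monom 1 i)) =
        (\<Sum>j<n. if j = i then v ! j else 0)"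
      using that by (simp add: sum_distrib_right constacyclic_trace_sum trace_monom_mult_invert)
    then have "v ! i = constacyclic_trace lam n (Poly v * invert (monom 1 i))"
      using that by simp
    also have "\<dots> = constacyclic_trace lam n (a * invert (monom 1 i))"
      using v(2) by (intro constacyclic_trace_congr[OF n_pos] congr_mult) (auto intro: congr_sym)
    also have "\<dots> = 0"
      by (rule assms)
    finally show ?thesis .
  qed
  then have "Poly v = 0"
    using v(1) by (simp add: Poly_as_sum[of v])
  then show ?thesis
    using v(2) by (simp add: congr_0_iff)
qed

text \<open>Orthogonality to the code says that the trace vanishes on all multiples of v(x) times
  the inverted \<open>g\<close>. Nondegeneracy turns this into a divisibility, and the involution
  moves the inversion from \<open>g\<close> to \<open>v\<close>.\<close>

lemma mem_dual_generated_code_iff: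
  "v \<in> dual_code n (generated_code lam n g) \<longleftrightarrow>
     length v = n \<and> modulus dvd g * invert (Poly v)"
proof (cases "length v = n")
  case len: True
  have "(\<forall>w\<in>generated_code lam n g. (\<Sum>i<n. v ! i * w ! i) = 0) \<longleftrightarrow>
      (\<forall>b. constacyclic_trace lam n (Poly v * invert (g * b)) = 0)"
  proof (intro iffI allI ballI)
    fix b
    assume *: "\<forall>w\<in>generated_code lam n g. (\<Sum>i<n. v ! i * w ! i) = 0"
    obtain w where w: "length w = n" "g * b \<cong> Poly w"
      using ex_reduced_representative[OF n_pos] by metis
    then have "w \<in> generated_code lam n g"
      unfolding mem_generated_code_iff using congr_sym by blast
    moreover have "constacyclic_trace lam n (Poly v * invert (g * b)) =
        constacyclic_trace lam n (Poly v * invert (Poly w))"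
      using w by (intro constacyclic_trace_congr[OF n_pos] congr_mult invert_cong congr_refl)
    ultimately show "constacyclic_trace lam n (Poly v * invert (g * b)) = 0"
      using * len w by (simp add: trace_Poly_mult_invert)
  next
    fix w
    assume *: "\<forall>b. constacyclic_trace lam n (Poly v * invert (g * b)) = 0"
    assume "w \<in> generated_code lam n g"
    then obtain b where b: "length w = n" "Poly w \<cong> g * b"
      unfolding mem_generated_code_iff by blast
    have "(\<Sum>i<n. v ! i * w ! i) = constacyclic_trace lam n (Poly v * invert (Poly w))"
      using len b by (simp add: trace_Poly_mult_invert)
    also have "\<dots> = constacyclic_trace lam n (Poly v * invert (g * b))"
      using b by (intro constacyclic_trace_congr[OF n_pos] congr_mult invert_cong congr_refl)
    finally show "(\<Sum>i<n. v ! i * w ! i) = 0"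
      using * by simp
  qed
  also have "\<dots> \<longleftrightarrow> modulus dvd Poly v * invert g"
  proof
    assume *: "\<forall>b. constacyclic_trace lam n (Poly v * invert (g * b)) = 0"
    show "modulus dvd Poly v * invert g"
    proof (rule trace_nondegenerate)
      fix b
      \<comment> \<open>Every multiplier is, up to congruence, an inverted polynomial, so the
        hypothesis covers arbitrary \<open>b\<close>.\<close>
      have "Poly v * invert g * b \<cong> Poly v * invert g * invert (invert b)"
        by (intro congr_mult congr_refl congr_sym[OF invert_invert])
      also have "\<dots> = Poly v * invert (g * invert b)"
        by (simp add: pcompose_mult mult.assoc)
      finally show "constacyclic_trace lam n (Poly v * invert g * b) = 0"
        using * constacyclic_trace_congr[OF n_pos] by metis
    qed
  next
    assume "modulus dvd Poly v * invert g"
    then have "modulus dvd Poly v * invert (g * b)" for b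
      by (simp add: pcompose_mult flip: mult.assoc)
    then show "\<forall>b. constacyclic_trace lam n (Poly v * invert (g * b)) = 0"
      using constacyclic_trace_eq_0[OF n_pos] by blast
  qed
  also have "\<dots> \<longleftrightarrow> modulus dvd g * invert (Poly v)"
  proof
    assume "modulus dvd Poly v * invert g"
    then have "modulus dvd invert (Poly v * invert g)"
      using invert_cong[of _ 0] by (simp add: congr_0_iff)
    moreover have "invert (Poly v * invert g) \<cong> invert (Poly v) * g"
      unfolding pcompose_mult by (intro congr_mult congr_refl invert_invert)
    ultimately show "modulus dvd g * invert (Poly v)"
      by (simp add: congr_dvd_iff mult.commute)
  next
    assume "modulus dvd g * invert (Poly v)"
    then have "modulus dvd invert (g * invert (Poly v))"
      using invert_cong[of _ 0] by (simp add: congr_0_iff)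
    moreover have "invert (g * invert (Poly v)) \<cong> invert g * Poly v"
      unfolding pcompose_mult by (intro congr_mult congr_refl invert_invert)
    ultimately show "modulus dvd Poly v * invert g"
      by (simp add: congr_dvd_iff mult.commute)
  qed
  finally show ?thesis
    using len by (simp add: dual_code_def)
next
  case False
  then show ?thesis
    by (simp add: dual_code_def)
qed

text \<open>This is the formula x^d a(1/x) for the reciprocal, with \<open>x_inv\<close> in the role
  of 1/x.\<close>

lemma reflect_poly_cong: "[:0, 1:] ^ degree a * invert a \<cong> reflect_poly a"
proof -
  have "invert a = invert (\<Sum>i\<le>degree a. monom (coeff a i) i)"
    by (simp add: poly_as_sum_of_monoms)
  also have "\<dots> = (\<Sum>i\<le>degree a. [:coeff a i:] * x_inv ^ i)"
    using invert_power[of "[:0, 1:]"]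
    by (simp add: monom_altdef pcompose_sum pcompose_smult invert_x)
  finally have "[:0, 1:] ^ degree a * invert a =
      (\<Sum>i\<le>degree a. [:0, 1:] ^ degree a * ([:coeff a i:] * x_inv ^ i))"
    by (simp only: sum_distrib_left)
  also have "\<dots> \<cong> (\<Sum>i\<le>degree a. [:coeff a i:] * [:0, 1:] ^ (degree a - i))"
  proof (rule congr_sum)
    fix i assume "i \<in> {..degree a}"
    then have "[:0, 1:] ^ degree a = ([:0, 1:] ^ (degree a - i) * [:0, 1:] ^ i :: 'a poly)"
      by (simp flip: power_add)
    then have "[:0, 1:] ^ degree a * ([:coeff a i:] * x_inv ^ i) =
        [:coeff a i:] * [:0, 1:] ^ (degree a - i) * ([:0, 1:] ^ i * x_inv ^ i)"
      by (simp only: mult_ac)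
    also have "\<dots> \<cong> [:coeff a i:] * [:0, 1:] ^ (degree a - i) * 1"
      by (intro congr_mult congr_refl x_inv_power_cong)
    finally show "[:0, 1:] ^ degree a * ([:coeff a i:] * x_inv ^ i) \<cong>
        [:coeff a i:] * [:0, 1:] ^ (degree a - i)"
      by simp
  qed
  also have "\<dots> = (\<Sum>i\<le>degree a. monom (coeff a (degree a - i)) i)"
    by (rule sum.reindex_bij_witness[of _ "\<lambda>i. degree a - i" "\<lambda>i. degree a - i"])
      (auto simp: monom_altdef)
  also have "\<dots> = reflect_poly a"
    by (rule poly_eqI) (auto simp: coeff_sum coeff_reflect_poly)
  finally show ?thesis .
qed

text \<open>Up to the unit \<open>x\<close>, the reciprocal is the image under \<open>x \<mapsto> x\<^sup>-\<^sup>1\<close>.\<close>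

lemma ex_mult_reflect_cong_iff:
  "(\<exists>b. a \<cong> (\<Prod>i\<in>A. reflect_poly (f i) ^ k i) * b) \<longleftrightarrow>
     (\<exists>b. a \<cong> invert (\<Prod>i\<in>A. f i ^ k i) * b)"
proof -
  \<comment> \<open>The total power of x that separates the product of reciprocals from the inverted
    product, one factor x^(deg f_i) for each occurrence of f_i.\<close>
  define D where "D = (\<Sum>i\<in>A. degree (f i) * k i)"
  define g where "g = invert (\<Prod>i\<in>A. f i ^ k i)"
  define h where "h = (\<Prod>i\<in>A. reflect_poly (f i) ^ k i)"
  have "[:0, 1:] ^ D * g = (\<Prod>i\<in>A. ([:0, 1:] ^ degree (f i) * invert (f i)) ^ k i)"
    unfolding D_def g_def invert_prod invert_power
    by (simp add: power_sum prod.distrib power_mult power_mult_distrib)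
  also have "\<dots> \<cong> h"
    unfolding h_def by (intro congr_prod congr_power reflect_poly_cong)
  finally have h: "[:0, 1:] ^ D * g \<cong> h" .
  have g: "g \<cong> h * x_inv ^ D"
  proof -
    have "g = 1 * g"
      by simp
    also have "\<dots> \<cong> ([:0, 1:] ^ D * x_inv ^ D) * g"
      by (intro congr_mult congr_sym[OF x_inv_power_cong] congr_refl)
    also have "\<dots> = ([:0, 1:] ^ D * g) * x_inv ^ D"
      by (simp only: mult_ac)
    also have "\<dots> \<cong> h * x_inv ^ D"
      by (intro congr_mult h congr_refl)
    finally show ?thesis .
  qed
  have "h * b \<cong> g * ([:0, 1:] ^ D * b)" "g * b \<cong> h * (x_inv ^ D * b)" for b
    using congr_mult[OF congr_sym[OF h] congr_refl[of _ b]] congr_mult[OF g congr_refl[of _ b]]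
    by (simp_all only: mult_ac)
  then show ?thesis
    unfolding g_def[symmetric] h_def[symmetric] using congr_trans by blast
qed

end

section \<open>The ideal structure modulo \<open>x^n - lam\<close>\<close>

text \<open>Zero divisors among the coefficients do no harm: as \<open>N\<close> is monic, the
  leading coefficient of the cofactor survives in the product.\<close>

lemma monic_dvd_low_degree:
  fixes N a :: "'a::comm_ring_1 poly"
  assumes "lead_coeff N = 1" "N dvd a" "degree a < degree N"
  shows "a = 0"
proof -
  obtain q where q: "a = N * q"
    using assms(2) by (auto simp: dvd_def)
  have "coeff a (degree N + degree q) = lead_coeff q"
    by (simp add: q coeff_mult_degree_sum assms(1))
  moreover have "coeff a (degree N + degree q) = 0"
    using assms(3) by (intro coeff_eq_0) simp
  ultimately show ?thesis
    by (simp add: q)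
qed

lemma degree_monom_diff_const:
  fixes c :: "'a::comm_ring_1"
  assumes "n \<ge> 1"
  shows "degree (monom 1 n - [:c:]) = n" "lead_coeff (monom 1 n - [:c:]) = 1"
proof -
  have *: "coeff (monom 1 n - [:c:]) n = 1"
    using assms by (cases n) simp_all
  have "degree (monom 1 n - [:c:]) \<le> n"
    by (intro degree_diff_le) (auto intro: degree_monom_le)
  moreover have "n \<le> degree (monom 1 n - [:c:])"
    by (rule le_degree) (subst *, simp)
  ultimately show "degree (monom 1 n - [:c:]) = n"
    by simp
  then show "lead_coeff (monom 1 n - [:c:]) = 1"
    using * by simp
qed

text \<open>Since \<open>w\<close> is a unit, x^n - a1 and u generate the same ideal of the quotient
  ring, so the polynomial \<open>base\<close> over the residue field takes over the role of
  u.\<close>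

locale ramified_modulus =
  fixes a1 :: "'k::field" and lam w w_inv :: "('k, 'e::finite) chain_ring" and n :: nat
  assumes n_pos: "n \<ge> 1"
    and lam_eq: "lam = cr_const a1 + cr_u * w"
    and w_unit: "w * w_inv = 1"
begin

abbreviation "base \<equiv> monom 1 n - [:a1:]"

abbreviation "modulus \<equiv> monom 1 n - [:lam:]"

abbreviation cong_mod (infix \<open>\<cong>\<close> 50) where "cong_mod \<equiv> congr modulus"

lemma lift_base: "lift_poly base = modulus + [:cr_u * w:]"
proof -
  have "lift_poly (monom 1 n) = (monom 1 n :: ('k, 'e) chain_ring poly)"
    by (rule poly_eqI) (simp add: coeff_lift_poly)
  moreover have "lift_poly [:a1:] = [:cr_const a1 :: ('k, 'e) chain_ring:]"
    by (simp add: map_poly_pCons)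
  ultimately show ?thesis
    by (simp add: lift_poly_diff lam_eq)
qed

lemma lift_base_cong: "lift_poly base \<cong> [:cr_u * w:]"
  unfolding lift_base by (simp add: congr_def)

lemma const_power: "[:c:] ^ k = ([:c ^ k:] :: 'c::comm_ring_1 poly)"
  by (induction k) (auto simp: one_pCons)

lemma lift_base_power_cong: "lift_poly base ^ k \<cong> [:cr_u ^ k * w ^ k:]"
  using congr_power[OF lift_base_cong, of k] by (simp add: const_power power_mult_distrib)

lemma lift_base_nilpotent: "lift_poly base ^ CARD('e) \<cong> 0"
  using lift_base_power_cong[of "CARD('e)"] by (simp add: cr_u_nilpotent)

text \<open>As \<open>u\<close> is a unit multiple of the nilpotent element \<open>x^n - a1\<close>, scalars of the residue
  field suffice to represent every class.\<close>

lemma ex_lift_cong: "\<exists>a0. a \<cong> lift_poly a0"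
proof -
  \<comment> \<open>Successive approximation: each round expands the error term by one more power of
    \<open>base\<close>, and the power e vanishes.\<close>
  have "\<exists>a0 b. a \<cong> lift_poly a0 + lift_poly base ^ k * b" for k
  proof (induction k)
    case 0
    have "a = lift_poly 0 + lift_poly base ^ 0 * a"
      by simp
    then show ?case
      by (metis congr_refl)
  next
    case (Suc k)
    obtain a0 b where ab: "a \<cong> lift_poly a0 + lift_poly base ^ k * b"
      using Suc by blast
    obtain b0 c where b: "b = lift_poly b0 + [:cr_u:] * c"
      by (rule poly_decomp)
    have "[:cr_u:] = [:cr_u * w:] * [:w_inv:]"
      using w_unit by (simp add: mult_ac)
    also have "\<dots> \<cong> lift_poly base * [:w_inv:]"
      by (intro congr_mult congr_sym[OF lift_base_cong] congr_refl)
    finally have u: "[:cr_u:] \<cong> lift_poly base * [:w_inv:]" .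
    have "b \<cong> lift_poly b0 + lift_poly base * [:w_inv:] * c"
      unfolding b by (intro congr_add congr_mult u congr_refl)
    then have "lift_poly a0 + lift_poly base ^ k * b \<cong>
        lift_poly a0 + lift_poly base ^ k * (lift_poly b0 + lift_poly base * [:w_inv:] * c)"
      by (intro congr_add congr_mult congr_refl)
    also have "\<dots> = lift_poly (a0 + base ^ k * b0) + lift_poly base ^ Suc k * ([:w_inv:] * c)"
      by (simp only: lift_poly_add lift_poly_mult lift_poly_power power_Suc algebra_simps)
    finally show ?case
      using ab congr_trans by blast
  qed
  then obtain a0 b where ab: "a \<cong> lift_poly a0 + lift_poly base ^ CARD('e) * b"
    by blast
  also have "\<dots> \<cong> lift_poly a0 + 0 * b"
    by (intro congr_add congr_mult lift_base_nilpotent congr_refl)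
  finally show ?thesis
    by auto
qed

text \<open>The factor u^(e-1) kills u and therefore \<open>base\<close>, so only the remainder
  \<open>r\<close> of \<open>b\<close> survives. Its degree is below n, which forces u^(e-1) r = 0
  and then r = 0.\<close>

lemma base_dvd_if_socle:
  assumes "modulus dvd [:cr_u ^ (CARD('e) - 1):] * lift_poly b"
  shows "base dvd b"
proof -
  define c where "c = b div base"
  define r where "r = b mod base"
  define z :: "('k, 'e) chain_ring poly" where "z = [:cr_u ^ (CARD('e) - 1):]"
  have b: "b = base * c + r"
    by (simp add: c_def r_def)
  have "base \<noteq> 0"
    using degree_monom_diff_const[OF n_pos, of a1] n_pos by fastforce
  then have r: "r = 0 \<or> degree r < n"
    using degree_mod_less[of base b] degree_monom_diff_const[OF n_pos, of a1] by (simp add: r_def)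
  have "cr_u ^ (CARD('e) - 1) * cr_u = (0 :: ('k, 'e) chain_ring)"
    using cr_u_nilpotent[where 'k = 'k and 'e = 'e] zero_less_card_finite[where 'a = 'e]
    by (metis power_minus_mult)
  then have "cr_u ^ (CARD('e) - 1) * (cr_u * w) = 0"
    by (simp only: mult_zero_left flip: mult.assoc)
  then have "z * [:cr_u * w:] = 0"
    by (simp add: z_def mult.commute)
  then have "z * lift_poly base \<cong> 0"
    using congr_mult[OF congr_refl[of _ z] lift_base_cong] by simp
  then have "z * lift_poly base * lift_poly c + z * lift_poly r \<cong> 0 * lift_poly c + z * lift_poly r"
    by (intro congr_add congr_mult congr_refl)
  moreover have "z * lift_poly b = z * lift_poly base * lift_poly c + z * lift_poly r"
    by (simp only: b lift_poly_add lift_poly_mult distrib_left mult.assoc)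
  ultimately have "z * lift_poly b \<cong> z * lift_poly r"
    by simp
  then have dvd: "modulus dvd z * lift_poly r"
    using assms congr_dvd_iff z_def by blast
  have coeff: "coeff (z * lift_poly r) i = cr_u ^ (CARD('e) - 1) * cr_const (coeff r i)" for i
    by (simp add: z_def coeff_lift_poly)
  have "r = 0"
  proof (rule ccontr)
    assume "r \<noteq> 0"
    then have "degree (z * lift_poly r) < n"
      using r by (metis (no_types) coeff coeff_eq_0 cr_const_0 degree_lessI linorder_not_less
          mult_zero_right n_pos not_one_le_zero order_less_le_trans)
    then have "z * lift_poly r = 0"
      using monic_dvd_low_degree[OF _ dvd] degree_monom_diff_const[OF n_pos, of lam] by simp
    then have "coeff r i = 0" for i
      using coeff[of i] cr_u_power_mult_const_eq_0 by simp
    with \<open>r \<noteq> 0\<close> show False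
      by (simp add: poly_eq_iff)
  qed
  then show ?thesis
    using b by simp
qed

text \<open>The kernel of the map from K[x] to the quotient ring is contained in the ideal of
  \<open>base ^ CARD('e)\<close>. Factors \<open>base\<close> are split off one at a time, each by a
  multiplication into the socle.\<close>

lemma lift_dvd_imp:
  assumes "modulus dvd lift_poly a"
  shows "base ^ CARD('e) dvd a"
proof -
  have "base ^ k dvd a" if "k \<le> CARD('e)" for k
    using that
  proof (induction k)
    case 0
    show ?case
      by simp
  next
    case (Suc k)
    then obtain b where b: "a = base ^ k * b"
      by (auto simp: dvd_def)
    have "lift_poly a \<cong> [:cr_u ^ k * w ^ k:] * lift_poly b"
      unfolding b lift_poly_mult lift_poly_power
      by (intro congr_mult lift_base_power_cong congr_refl)
    then have "modulus dvd [:cr_u ^ k * w ^ k:] * lift_poly b"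
      using assms congr_dvd_iff by blast
    \<comment> \<open>The multiplier cancels w^k and raises u^k to u^(e-1). The exponent e - 1 - k
      is a true difference because the induction step has k < e.\<close>
    then have *: "modulus dvd
        [:cr_u ^ (CARD('e) - 1 - k) * w_inv ^ k:] * ([:cr_u ^ k * w ^ k:] * lift_poly b)"
      by (rule dvd_mult)
    have "[:cr_u ^ (CARD('e) - 1 - k) * w_inv ^ k:] * [:cr_u ^ k * w ^ k:] =
        [:cr_u ^ (CARD('e) - 1 - k + k) * (w * w_inv) ^ k:]"
      by (simp add: power_add power_mult_distrib mult_ac)
    then have "[:cr_u ^ (CARD('e) - 1 - k) * w_inv ^ k:] * [:cr_u ^ k * w ^ k:] =
        [:cr_u ^ (CARD('e) - 1):]"
      using Suc.prems by (simp add: w_unit)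
    with * have "modulus dvd [:cr_u ^ (CARD('e) - 1):] * lift_poly b"
      by (simp only: flip: mult.assoc)
    then have "base dvd b"
      by (rule base_dvd_if_socle)
    then show ?case
      unfolding b by (simp add: mult.commute mult_dvd_mono)
  qed
  then show ?thesis
    by simp
qed

text \<open>With \<open>a\<close> represented by \<open>a0\<close> over the residue field, the
  kernel gives that g h divides g a0, and \<open>g\<close> cancels in the domain K[x]. Conversely g
  h lifts to a power of \<open>base\<close> that vanishes.\<close>

lemma annihilator_lift:
  assumes "g * h = base ^ CARD('e)"
  shows "modulus dvd lift_poly g * a \<longleftrightarrow> (\<exists>b. a \<cong> lift_poly h * b)"
proof
  assume *: "modulus dvd lift_poly g * a"
  obtain a0 where a0: "a \<cong> lift_poly a0"
    using ex_lift_cong by blast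
  have "lift_poly g * a \<cong> lift_poly (g * a0)"
    unfolding lift_poly_mult by (intro congr_mult a0 congr_refl)
  then have "g * h dvd g * a0"
    using * assms lift_dvd_imp congr_dvd_iff by metis
  moreover have "g \<noteq> 0"
  proof
    assume "g = 0"
    then have "base = 0"
      using assms zero_less_card_finite[where 'a = 'e] by (metis mult_zero_left power_eq_0_iff)
    then show False
      using degree_monom_diff_const[OF n_pos, of a1] n_pos by fastforce
  qed
  ultimately obtain b where "a0 = h * b"
    by (auto simp: dvd_def mult.assoc)
  then show "\<exists>b. a \<cong> lift_poly h * b"
    using a0 lift_poly_mult by metis
next
  assume "\<exists>b. a \<cong> lift_poly h * b"
  then obtain b where "a \<cong> lift_poly h * b" ..
  then have "lift_poly g * a \<cong> lift_poly g * (lift_poly h * b)"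
    by (intro congr_mult congr_refl)
  also have "\<dots> = lift_poly base ^ CARD('e) * b"
    by (simp add: assms flip: mult.assoc lift_poly_mult lift_poly_power)
  also have "\<dots> \<cong> 0 * b"
    by (intro congr_mult lift_base_nilpotent congr_refl)
  finally show "modulus dvd lift_poly g * a"
    by (simp add: congr_0_iff)
qed

end

section \<open>The dual code\<close>

lemma linear_dual_code: "linear_code n (dual_code n C)"
  unfolding linear_code_def dual_code_def
  by (auto simp: distrib_right sum.distrib mult.assoc simp flip: sum_distrib_left)

text \<open>The backward shift is multiplication by \<open>x\<^sup>-\<^sup>1\<close>.\<close>

lemma generated_code_backward_shift:
  fixes lam mu :: "'a::comm_ring_1"
  assumes "n \<ge> 1" "lam * mu = 1" "w \<in> generated_code lam n g"
  shows "tl w @ [mu * hd w] \<in> generated_code lam n g"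
proof -
  let ?N = "monom 1 n - [:lam:]"
  define w' where "w' = tl w @ [mu * hd w]"
  obtain a where len: "length w = n" and a: "congr ?N (Poly w) (g * a)"
    using assms(3) unfolding mem_generated_code_iff by blast
  then have "w \<noteq> []"
    using assms(1) by auto
  have len': "length w' = n"
    using len assms(1) by (simp add: w'_def)
  have "Poly w' = Poly (tl w) + monom (mu * hd w) (n - 1)"
    using len by (simp add: w'_def Poly_append mult_monom flip: monom_0)
  then have "[:0, 1:] * Poly w' = pCons 0 (Poly (tl w)) + pCons 0 (monom (mu * hd w) (n - 1))"
    by simp
  also have "pCons 0 (monom (mu * hd w) (n - 1)) = monom (mu * hd w) n"
    using assms(1) by (cases n) (simp_all add: monom_Suc)
  finally have x_w'_eq: "[:0, 1:] * Poly w' = pCons 0 (Poly (tl w)) + monom (mu * hd w) n" .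
  have "Poly w = [:hd w:] + pCons 0 (Poly (tl w))"
    using \<open>w \<noteq> []\<close> by (cases w) simp_all
  with x_w'_eq have "[:0, 1:] * Poly w' - Poly w = monom (mu * hd w) n - [:hd w:]"
    by (simp only: diff_add_eq_diff_diff_swap add.commute[of "pCons 0 _"] add_diff_cancel_right')
  also have "[:hd w:] = [:lam * (mu * hd w):]"
    by (simp add: assms(2) flip: mult.assoc)
  also have "monom (mu * hd w) n - \<dots> = [:mu * hd w:] * ?N"
    by (simp add: smult_diff_right smult_monom mult.commute)
  finally have x_w': "congr ?N ([:0, 1:] * Poly w') (Poly w)"
    by (metis congr_def dvd_triv_right)
  \<comment> \<open>This makes mu x^(n-1) an inverse of x, by which x cancels from the congruence
    between x w'(x) and w(x).\<close>
  have "[:mu:] * monom 1 n - 1 = [:mu:] * ?N"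
    using assms(2) by (simp add: smult_diff_right mult.commute one_pCons)
  then have unit: "congr ?N ([:mu:] * monom 1 n) 1"
    by (metis congr_def dvd_triv_right)
  have x_n: "monom 1 n = monom 1 (n - 1) * ([:0, 1:] :: 'a poly)"
    using assms(1) by (cases n) (simp_all add: monom_Suc)
  have "Poly w' = 1 * Poly w'"
    by simp
  also have "congr ?N \<dots> ([:mu:] * monom 1 n * Poly w')"
    by (intro congr_mult congr_sym[OF unit] congr_refl)
  also have "[:mu:] * monom 1 n * Poly w' = [:mu:] * monom 1 (n - 1) * ([:0, 1:] * Poly w')"
    by (simp only: x_n mult.assoc)
  also have "congr ?N \<dots> ([:mu:] * monom 1 (n - 1) * (g * a))"
    by (intro congr_mult congr_refl congr_trans[OF x_w' a])
  also have "\<dots> = g * ([:mu:] * monom 1 (n - 1) * a)"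
    by (simp only: mult_ac)
  finally have "congr ?N (Poly w') (g * ([:mu:] * monom 1 (n - 1) * a))" .
  then show ?thesis
    using len' unfolding mem_generated_code_iff w'_def by blast
qed

text \<open>The forward shift by \<open>mu\<close> is adjoint to the backward shift: pairing the
  shifted \<open>v\<close> with \<open>w\<close> equals pairing \<open>v\<close> with the backward
  shift of \<open>w\<close>, which stays in the code.\<close>

lemma constacyclic_dual_generated_code:
  fixes lam mu :: "'a::comm_ring_1"
  assumes "n \<ge> 1" "lam * mu = 1"
  shows "constacyclic_code mu n (dual_code n (generated_code lam n g))"
proof -
  have "constacyclic_shift mu v \<in> dual_code n (generated_code lam n g)"
    if v: "v \<in> dual_code n (generated_code lam n g)" for v
  proof -
    obtain k where k: "n = Suc k"
      using assms(1) by (cases n) auto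
    have len: "length v = n"
      using v by (simp add: dual_code_def)
    then have last: "last v = v ! k"
      using k by (metis diff_Suc_1 last_conv_nth length_0_conv nat.distinct(1))
    have "(\<Sum>i<n. constacyclic_shift mu v ! i * w ! i) = 0"
      if w: "w \<in> generated_code lam n g" for w
    proof -
      have lenw: "length w = n"
        using w by (simp add: mem_generated_code_iff)
      then have hd: "hd w = w ! 0"
        using k by (intro hd_conv_nth) auto
      have "(\<Sum>i<n. constacyclic_shift mu v ! i * w ! i) =
          mu * v ! k * w ! 0 + (\<Sum>i<k. v ! i * w ! Suc i)"
        using len last by (simp add: k sum.lessThan_Suc_shift constacyclic_shift_def nth_butlast del: sum.lessThan_Suc)
      also have "\<dots> = (\<Sum>i<n. v ! i * (tl w @ [mu * hd w]) ! i)"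
        using lenw hd by (simp add: k nth_append nth_tl mult_ac)
      also have "\<dots> = 0"
        using v generated_code_backward_shift[OF assms w] by (simp add: dual_code_def)
      finally show ?thesis .
    qed
    then show ?thesis
      using len k by (simp add: dual_code_def constacyclic_shift_def)
  qed
  moreover have "mu dvd 1"
    using assms(2) by (metis dvd_triv_right)
  ultimately show ?thesis
    by (simp add: constacyclic_code_def linear_dual_code)
qed

text \<open>A vector lies in the dual iff its inverted polynomial annihilates the generator, that
  is, lies in the ideal of the complementary product. Undoing the inversion replaces each factor by
  its reciprocal.\<close>

lemma dual_generated_code_eq:
  fixes a1 :: "'k::field" and lam w w_inv :: "('k, 'e::finite) chain_ring"
  assumes "n \<ge> 1" "lam = cr_const a1 + cr_u * w" "w * w_inv = 1" "lam * lam = 1"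
    and "(\<Prod>i\<in>A. f i ^ t i) * (\<Prod>i\<in>A. f i ^ k i) = (monom 1 n - [:a1:]) ^ CARD('e)"
  shows "dual_code n (generated_code lam n (\<Prod>i\<in>A. lift_poly (f i) ^ t i)) =
    generated_code lam n (\<Prod>i\<in>A. lift_poly (reflect_poly (f i)) ^ k i)"
proof -
  interpret M: ramified_modulus a1 lam w w_inv n
    using assms(1-3) by unfold_locales
  interpret S: self_inverse_constacyclic lam n
    using assms(1,4) by unfold_locales
  let ?N = "monom 1 n - [:lam:]"
  have "congr ?N a (S.invert h * S.invert b)" if "congr ?N (S.invert a) (h * b)" for a h b
    using congr_trans[OF congr_sym[OF S.invert_invert] S.invert_cong[OF that]]
    by (simp only: pcompose_mult)
  moreover have "congr ?N (S.invert a) (h * S.invert b)" if "congr ?N a (S.invert h * b)" for a h b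
  proof -
    have "congr ?N (S.invert a) (S.invert (S.invert h) * S.invert b)"
      using S.invert_cong[OF that] by (simp only: pcompose_mult)
    also have "congr ?N \<dots> (h * S.invert b)"
      by (intro congr_mult S.invert_invert congr_refl)
    finally show ?thesis .
  qed
  ultimately have "(\<exists>b. congr ?N (S.invert a) (h * b)) \<longleftrightarrow> (\<exists>b. congr ?N a (S.invert h * b))" for a h
    by blast
  then have "(\<exists>b. congr ?N (S.invert a) (lift_poly (\<Prod>i\<in>A. f i ^ k i) * b)) \<longleftrightarrow>
      (\<exists>b. congr ?N a ((\<Prod>i\<in>A. lift_poly (reflect_poly (f i)) ^ k i) * b))" for a
    by (simp only: lift_poly_reflect lift_poly_prod lift_poly_power S.ex_mult_reflect_cong_iff)
  then show ?thesis
    using M.annihilator_lift[OF assms(5)]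
    unfolding set_eq_iff S.mem_dual_generated_code_iff mem_generated_code_iff
    by (simp only: lift_poly_prod lift_poly_power simp_thms)
qed

text \<open>Isolates the cofactor of u, which is a unit as soon as its constant term \<alpha> 2 is
  nonzero; e \<ge> 2 ensures that this term occurs in the sum.\<close>

lemma sum_cr_u_power_decomp:
  fixes \<alpha> :: "nat \<Rightarrow> 'k::field"
  assumes "e \<ge> 2"
  obtains b where "(\<Sum>j=1..e. cr_u ^ (j - 1) * cr_const (\<alpha> j)) =
    (cr_const (\<alpha> 1) + cr_u * (cr_const (\<alpha> 2) + cr_u * b) :: ('k, 'e::finite) chain_ring)"
proof -
  let ?f = "\<lambda>j. cr_u ^ (j - 1) * cr_const (\<alpha> j) :: ('k, 'e) chain_ring"
  have "(\<Sum>j=1..e. ?f j) = ?f 1 + (?f 2 + (\<Sum>j=3..e. ?f j))"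
  proof -
    have "{1..e} = insert 1 (insert 2 {3..e})"
      using assms by auto
    then show ?thesis
      by simp
  qed
  also have "(\<Sum>j=3..e. ?f j) = (\<Sum>j=3..e. cr_u * (cr_u * (cr_u ^ (j - 3) * cr_const (\<alpha> j))))"
  proof (rule sum.cong)
    fix j assume "j \<in> {3..e}"
    then have "3 \<le> j"
      by simp
    then have "j - 1 = Suc (Suc (j - 3))"
      by linarith
    then show "?f j = cr_u * (cr_u * (cr_u ^ (j - 3) * cr_const (\<alpha> j)))"
      by (simp only: power_Suc mult.assoc)
  qed simp
  also have "\<dots> = cr_u * (cr_u * (\<Sum>j=3..e. cr_u ^ (j - 3) * cr_const (\<alpha> j)))"
    by (simp add: sum_distrib_left)
  finally show ?thesis
    using that[of "\<Sum>j=3..e. cr_u ^ (j - 3) * cr_const (\<alpha> j)"] by (simp add: distrib_left)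
qed

theorem theorem4p6:
  fixes p r m s e n l :: nat
    and \<alpha> :: "nat \<Rightarrow> 'k::{field,finite}"
    and lam :: "('k, 'e::finite) chain_ring"
    and f :: "nat \<Rightarrow> 'k poly"
    and t :: "nat \<Rightarrow> nat"
    and C :: "('k, 'e) chain_ring list set"
  assumes "prime p" and "r \<ge> 1" and "m \<ge> 1" and "e \<ge> 2" and "gcd m p = 1"
    and "n = m * p ^ s"
    and "CARD('k) = p ^ r" and "CARD('e) = e"
    and "lam = (\<Sum>j=1..e. cr_u ^ (j - 1) * cr_const (\<alpha> j))"
    and "\<alpha> 1 = \<alpha> 0 ^ (p ^ s)" and "\<alpha> 1 \<noteq> 0" and "\<alpha> 2 \<noteq> 0"
    and "\<And>i. i \<in> {1..l} \<Longrightarrow> irreducible (f i)"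
    and "\<And>i. i \<in> {1..l} \<Longrightarrow> lead_coeff (f i) = 1"
    and "\<And>i j. i \<in> {1..l} \<Longrightarrow> j \<in> {1..l} \<Longrightarrow> i \<noteq> j \<Longrightarrow> coprime (f i) (f j)"
    and "monom 1 n - [:\<alpha> 1:] = (\<Prod>i=1..l. f i ^ (p ^ s))"
    and "\<And>i. i \<in> {1..l} \<Longrightarrow> t i \<le> p ^ s * e"
    and "C = generated_code lam n (\<Prod>i=1..l. map_poly cr_const (f i) ^ t i)"
  shows "(\<exists>mu. lam * mu = 1 \<and> constacyclic_code mu n (dual_code n C)) \<and>
    (lam\<^sup>2 = 1 \<longrightarrow>
       constacyclic_code lam n (dual_code n C) \<and>
       dual_code n C = generated_code lam n
         (\<Prod>i=1..l. map_poly cr_const (reflect_poly (f i)) ^ (p ^ s * e - t i)))"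
proof -
  have n: "n \<ge> 1"
    using assms(1,3,6) by (simp add: prime_gt_0_nat Suc_le_eq)
  obtain b where lam: "lam = cr_const (\<alpha> 1) + cr_u * (cr_const (\<alpha> 2) + cr_u * b)"
    using sum_cr_u_power_decomp[OF assms(4), of \<alpha>] unfolding assms(9) by blast
  obtain mu where mu: "lam * mu = 1"
    unfolding lam by (rule chain_ring_unit[OF assms(11)])
  obtain w_inv where w_inv: "(cr_const (\<alpha> 2) + cr_u * b) * w_inv = 1"
    by (rule chain_ring_unit[OF assms(12)])
  \<comment> \<open>The bound on t i makes the subtraction exact, so the two exponents add up to p^s
    e.\<close>
  have "(\<Prod>i=1..l. f i ^ t i) * (\<Prod>i=1..l. f i ^ (p ^ s * e - t i)) = (\<Prod>i=1..l. f i ^ (p ^ s * e))"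
    unfolding prod.distrib[symmetric] using assms(17)
    by (intro prod.cong) (simp_all flip: power_add)
  also have "\<dots> = (monom 1 n - [:\<alpha> 1:]) ^ CARD('e)"
    unfolding assms(8,16) by (simp add: power_mult prod_power_distrib)
  finally have gh: "(\<Prod>i=1..l. f i ^ t i) * (\<Prod>i=1..l. f i ^ (p ^ s * e - t i)) =
    (monom 1 n - [:\<alpha> 1:]) ^ CARD('e)" .
  have dual: "constacyclic_code mu n (dual_code n C)"
    unfolding assms(18) by (rule constacyclic_dual_generated_code[OF n mu])
  moreover have "constacyclic_code lam n (dual_code n C) \<and>
      dual_code n C = generated_code lam n
        (\<Prod>i=1..l. map_poly cr_const (reflect_poly (f i)) ^ (p ^ s * e - t i))" if "lam\<^sup>2 = 1"
  proof -
    have sq: "lam * lam = 1"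
      using that by (simp add: power2_eq_square)
    \<comment> \<open>With \<open>lam\<close> as its own inverse, the first statement about the dual
      applies with \<open>lam\<close> in place of \<open>mu\<close>.\<close>
    show ?thesis
      using constacyclic_dual_generated_code[OF n sq] dual_generated_code_eq[OF n lam w_inv sq gh]
      unfolding assms(18) by (rule conjI)
  qed
  ultimately show ?thesis
    using mu by blast
qed

end
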